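(* Let $a,b,p,q$ be integers, let $(w_n)$ be the Horadam sequence $w_0=a$, $w_1=b$, $w_n=pw_{n-1}+qw_{n-2}$ for $n\ge 2$, and let $\mathbb{O}G_n=w_ne_0+w_{n+1}e_1+\dots+w_{n+7}e_7$ be the $n$-th Horadam octonion. Put $\alpha=\frac{p+\sqrt{p^2+4q}}{2}$, $\beta=\frac{p-\sqrt{p^2+4q}}{2}$, $A=b-a\beta$ and $B=b-a\alpha$. Then the Binet formula for Horadam octonions is $$\mathbb{O}G_n=\frac{A\underline{\alpha}\alpha^n-B\underline{\beta}\beta^n}{\alpha-\beta},$$ where $\underline{\alpha}=1e_0+\alpha e_1+\alpha^2e_2+\dots+\alpha^7e_7$ and $\underline{\beta}=1e_0+\beta e_1+\beta^2e_2+\dots+\beta^7e_7$.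
   Context: $\mathbb{O}$ is the eight-dimensional real octonion algebra with basis $e_0=1,e_1,\dots,e_7$; addition is componentwise. The numbers $\alpha,\beta$ are the roots of the characteristic equation $t^2-pt-q=0$ of the Horadam recurrence. *)

theory Defs
  imports Complex_Main
begin

text \<open>
  Octonions with coefficients in \<open>'a\<close>, given by their coordinates with respect to
  \<open>e\<^sub>0 = 1, e\<^sub>1, \<dots>, e\<^sub>7\<close>. The octonion algebra is \<open>real octonion\<close>. Its complexification
  \<open>complex octonion\<close> is needed because the roots of \<open>t\<^sup>2 - p t - q\<close> may be non-real.
\<close>

datatype 'a octonion =
  Octonion (oc0: 'a) (oc1: 'a) (oc2: 'a) (oc3: 'a) (oc4: 'a) (oc5: 'a) (oc6: 'a) (oc7: 'a)

instantiation octonion :: (ab_group_add) ab_group_add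
begin

definition zero_octonion :: "'a octonion" where
  "0 = Octonion 0 0 0 0 0 0 0 0"

definition plus_octonion :: "'a octonion \<Rightarrow> 'a octonion \<Rightarrow> 'a octonion" where
  "x + y = Octonion
    (oc0 x + oc0 y) (oc1 x + oc1 y) (oc2 x + oc2 y) (oc3 x + oc3 y)
    (oc4 x + oc4 y) (oc5 x + oc5 y) (oc6 x + oc6 y) (oc7 x + oc7 y)"

definition minus_octonion :: "'a octonion \<Rightarrow> 'a octonion \<Rightarrow> 'a octonion" where
  "x - y = Octonion
    (oc0 x - oc0 y) (oc1 x - oc1 y) (oc2 x - oc2 y) (oc3 x - oc3 y)
    (oc4 x - oc4 y) (oc5 x - oc5 y) (oc6 x - oc6 y) (oc7 x - oc7 y)"

definition uminus_octonion :: "'a octonion \<Rightarrow> 'a octonion" where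
  "- x = Octonion (- oc0 x) (- oc1 x) (- oc2 x) (- oc3 x) (- oc4 x) (- oc5 x) (- oc6 x) (- oc7 x)"

instance
  by standard
    (simp_all add: zero_octonion_def plus_octonion_def minus_octonion_def uminus_octonion_def
      algebra_simps)

end

text \<open>
  The product is the bilinear one with unit \<open>e\<^sub>0\<close>, \<open>e\<^sub>i e\<^sub>i = - e\<^sub>0\<close> for \<open>i \<ge> 1\<close>, and
  \<open>e\<^sub>i e\<^sub>j = e\<^sub>k = - e\<^sub>j e\<^sub>i\<close> for the cyclic rotations \<open>(i, j, k)\<close> of
  123, 145, 176, 246, 257, 347, 365.
\<close>

instantiation octonion :: (comm_ring_1) "{one, times}"
begin

definition one_octonion :: "'a octonion" where
  "1 = Octonion 1 0 0 0 0 0 0 0"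

definition times_octonion :: "'a octonion \<Rightarrow> 'a octonion \<Rightarrow> 'a octonion" where
  "x * y = Octonion
    (oc0 x * oc0 y - oc1 x * oc1 y - oc2 x * oc2 y - oc3 x * oc3 y
     - oc4 x * oc4 y - oc5 x * oc5 y - oc6 x * oc6 y - oc7 x * oc7 y)
    (oc0 x * oc1 y + oc1 x * oc0 y + oc2 x * oc3 y - oc3 x * oc2 y
     + oc4 x * oc5 y - oc5 x * oc4 y - oc6 x * oc7 y + oc7 x * oc6 y)
    (oc0 x * oc2 y - oc1 x * oc3 y + oc2 x * oc0 y + oc3 x * oc1 y
     + oc4 x * oc6 y + oc5 x * oc7 y - oc6 x * oc4 y - oc7 x * oc5 y)
    (oc0 x * oc3 y + oc1 x * oc2 y - oc2 x * oc1 y + oc3 x * oc0 y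
     + oc4 x * oc7 y - oc5 x * oc6 y + oc6 x * oc5 y - oc7 x * oc4 y)
    (oc0 x * oc4 y - oc1 x * oc5 y - oc2 x * oc6 y - oc3 x * oc7 y
     + oc4 x * oc0 y + oc5 x * oc1 y + oc6 x * oc2 y + oc7 x * oc3 y)
    (oc0 x * oc5 y + oc1 x * oc4 y - oc2 x * oc7 y + oc3 x * oc6 y
     - oc4 x * oc1 y + oc5 x * oc0 y - oc6 x * oc3 y + oc7 x * oc2 y)
    (oc0 x * oc6 y + oc1 x * oc7 y + oc2 x * oc4 y - oc3 x * oc5 y
     - oc4 x * oc2 y + oc5 x * oc3 y + oc6 x * oc0 y - oc7 x * oc1 y)
    (oc0 x * oc7 y - oc1 x * oc6 y + oc2 x * oc5 y + oc3 x * oc4 y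
     - oc4 x * oc3 y - oc5 x * oc2 y + oc6 x * oc1 y + oc7 x * oc0 y)"

instance ..

end

text \<open>The norm form is multiplicative, so this is the composition algebra of dimension 8.\<close>

definition oct_norm_form :: "'a::comm_ring_1 octonion \<Rightarrow> 'a" where
  "oct_norm_form x = (oc0 x)\<^sup>2 + (oc1 x)\<^sup>2 + (oc2 x)\<^sup>2 + (oc3 x)\<^sup>2
                   + (oc4 x)\<^sup>2 + (oc5 x)\<^sup>2 + (oc6 x)\<^sup>2 + (oc7 x)\<^sup>2"

lemma oct_norm_form_mult:
  "oct_norm_form (x * y) = oct_norm_form x * oct_norm_form y"
  by (cases x; cases y)
    (simp add: oct_norm_form_def times_octonion_def power2_eq_square algebra_simps)

definition oct_scale :: "'a::comm_ring_1 \<Rightarrow> 'a octonion \<Rightarrow> 'a octonion" (infixr \<open>*\<^sub>o\<close> 75) where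
  "c *\<^sub>o x = map_octonion (\<lambda>t. c * t) x"

lemma vector_space_oct_scale: "vector_space (oct_scale :: 'a::field \<Rightarrow> _)"
proof
  fix c d :: 'a and x y :: "'a octonion"
  show "c *\<^sub>o (x + y) = c *\<^sub>o x + c *\<^sub>o y"
    by (cases x; cases y) (simp add: oct_scale_def plus_octonion_def algebra_simps)
  show "(c + d) *\<^sub>o x = c *\<^sub>o x + d *\<^sub>o x"
    by (cases x) (simp add: oct_scale_def plus_octonion_def algebra_simps)
  show "c *\<^sub>o d *\<^sub>o x = (c * d) *\<^sub>o x"
    by (cases x) (simp add: oct_scale_def algebra_simps)
  show "1 *\<^sub>o x = x"
    by (cases x) (simp add: oct_scale_def)
qed

text \<open>The basis vectors \<open>e\<^sub>0, \<dots>, e\<^sub>7\<close>; only indices below 8 are meaningful.\<close>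

definition oct_basis :: "nat \<Rightarrow> 'a::comm_ring_1 octonion" where
  "oct_basis k = Octonion (of_bool (k = 0)) (of_bool (k = 1)) (of_bool (k = 2)) (of_bool (k = 3))
                          (of_bool (k = 4)) (of_bool (k = 5)) (of_bool (k = 6)) (of_bool (k = 7))"

abbreviation oct_complexify :: "real octonion \<Rightarrow> complex octonion" where
  "oct_complexify \<equiv> map_octonion complex_of_real"

fun horadam :: "int \<Rightarrow> int \<Rightarrow> int \<Rightarrow> int \<Rightarrow> nat \<Rightarrow> int" where
  "horadam a b p q 0 = a"
| "horadam a b p q (Suc 0) = b"
| "horadam a b p q (Suc (Suc n)) = p * horadam a b p q (Suc n) + q * horadam a b p q n"

definition horadam_octonion :: "int \<Rightarrow> int \<Rightarrow> int \<Rightarrow> int \<Rightarrow> nat \<Rightarrow> real octonion" where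
  "horadam_octonion a b p q n = (\<Sum>k\<le>7. real_of_int (horadam a b p q (n + k)) *\<^sub>o oct_basis k)"

text \<open>The octonion written \<open>x\<close> underlined, i.e. \<open>1 e\<^sub>0 + x e\<^sub>1 + \<dots> + x\<^sup>7 e\<^sub>7\<close>.\<close>

definition oct_underline :: "'a::comm_ring_1 \<Rightarrow> 'a octonion" where
  "oct_underline x = (\<Sum>k\<le>7. x ^ k *\<^sub>o oct_basis k)"

end

theory Submission
  imports Defs
begin

text \<open>Coordinate \<open>k\<close> of the Horadam octonion is w_(n+k), so the formula is the
  scalar Binet formula read in eight coordinates at once: \<alpha>^(n+k) = \<alpha>^n \<alpha>^k
  lets the factor \<alpha>^n come out and leaves the powers that form \<open>oct_underline\<close>,
  and likewise for \<beta>. The scalar formula (\<open>horadam_binet\<close>) holds because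
  \<alpha>^n and \<beta>^n both satisfy the recurrence. \<open>horadam_octonion_binet\<close> works
  over any field, so the real and the complex claims are two instances of it, with Vieta's relations
  supplied by \<open>quadratic_roots_vieta\<close>.\<close>

lemma sum_oct_basis:
  "(\<Sum>k\<le>7. c k *\<^sub>o oct_basis k) = Octonion (c 0) (c 1) (c 2) (c 3) (c 4) (c 5) (c 6) (c 7)"
  by (simp add: numeral_eq_Suc oct_scale_def oct_basis_def plus_octonion_def zero_octonion_def)

text \<open>Multiplying through by \<alpha> - \<beta> avoids division, so the identity makes sense
  in any commutative ring and even for \<alpha> = \<beta>. Only the elementary symmetric functions
  of the roots enter.\<close>

lemma horadam_binet:
  fixes \<alpha> \<beta> :: "'a::comm_ring_1"
  assumes sum: "\<alpha> + \<beta> = of_int p" and prod: "\<alpha> * \<beta> = - of_int q"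
  shows "(\<alpha> - \<beta>) * of_int (horadam a b p q n) =
    (of_int b - of_int a * \<beta>) * \<alpha> ^ n - (of_int b - of_int a * \<alpha>) * \<beta> ^ n"
proof (induction n rule: induct_nat_012)
  case 0
  then show ?case by (simp add: algebra_simps)
next
  case 1
  then show ?case by (simp add: algebra_simps)
next
  case (ge2 n)
  have q: "of_int q = - (\<alpha> * \<beta>)"
    using prod by simp
  have "(\<alpha> - \<beta>) * of_int (horadam a b p q (Suc (Suc n))) =
      (\<alpha> + \<beta>) * ((\<alpha> - \<beta>) * of_int (horadam a b p q (Suc n)))
      - \<alpha> * \<beta> * ((\<alpha> - \<beta>) * of_int (horadam a b p q n))"
    \<comment> \<open>The coefficients of the recurrence are first replaced by \<alpha> + \<beta>
      and -\<alpha>\<beta>; what remains is a ring identity.\<close>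
    by (simp add: q flip: sum) (simp add: algebra_simps)
  also have "\<dots> = (of_int b - of_int a * \<beta>) * \<alpha> ^ Suc (Suc n)
      - (of_int b - of_int a * \<alpha>) * \<beta> ^ Suc (Suc n)"
    \<comment> \<open>After the induction hypotheses this is (\<alpha> + \<beta>) x^(n+1) -
      \<alpha>\<beta> x^n = x^(n+2) for x = \<alpha> and x = \<beta>.\<close>
    unfolding ge2 by (simp add: algebra_simps)
  finally show ?case .
qed

lemma horadam_octonion_binet:
  fixes \<alpha> \<beta> :: "'a::field"
  assumes "\<alpha> + \<beta> = of_int p" "\<alpha> * \<beta> = - of_int q" "\<alpha> \<noteq> \<beta>"
  shows "(\<Sum>k\<le>7. of_int (horadam a b p q (n + k)) *\<^sub>o oct_basis k) =
    (1 / (\<alpha> - \<beta>)) *\<^sub>o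
      (((of_int b - of_int a * \<beta>) * \<alpha> ^ n) *\<^sub>o oct_underline \<alpha>
       - ((of_int b - of_int a * \<alpha>) * \<beta> ^ n) *\<^sub>o oct_underline \<beta>)"
proof -
  have "of_int (horadam a b p q (n + k)) = (1 / (\<alpha> - \<beta>)) *
      ((of_int b - of_int a * \<beta>) * \<alpha> ^ n * \<alpha> ^ k - (of_int b - of_int a * \<alpha>) * \<beta> ^ n * \<beta> ^ k)" for k
    using horadam_binet[OF assms(1,2), of a b "n + k"] assms(3)
    by (simp add: field_simps power_add)
  then show ?thesis
    unfolding oct_underline_def sum_oct_basis
    by (simp only: oct_scale_def octonion.map minus_octonion_def octonion.sel)
qed

text \<open>Here \<open>s\<close> is any square root of the discriminant, so that both
  \<open>sqrt\<close> and \<open>csqrt\<close> fit.\<close>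

lemma quadratic_roots_vieta:
  fixes p q s :: "'a::field_char_0"
  assumes "s\<^sup>2 = p\<^sup>2 + 4 * q"
  shows "(p + s) / 2 + (p - s) / 2 = p" and "(p + s) / 2 * ((p - s) / 2) = - q"
proof -
  show "(p + s) / 2 + (p - s) / 2 = p"
    by (simp flip: add_divide_distrib)
  have "(p + s) * (p - s) = p\<^sup>2 - s\<^sup>2"
    by (simp add: power2_eq_square algebra_simps)
  then show "(p + s) / 2 * ((p - s) / 2) = - q"
    using assms by simp
qed

theorem theorem3p1:
  fixes a b p q :: int and n :: nat
  assumes "p\<^sup>2 + 4 * q \<noteq> 0"
  shows
    "(0 < p\<^sup>2 + 4 * q \<longrightarrow>
       (let \<alpha> = (real_of_int p + sqrt (real_of_int (p\<^sup>2 + 4 * q))) / 2;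
            \<beta> = (real_of_int p - sqrt (real_of_int (p\<^sup>2 + 4 * q))) / 2;
            A = real_of_int b - real_of_int a * \<beta>;
            B = real_of_int b - real_of_int a * \<alpha>
        in horadam_octonion a b p q n =
             (1 / (\<alpha> - \<beta>)) *\<^sub>o ((A * \<alpha> ^ n) *\<^sub>o oct_underline \<alpha> - (B * \<beta> ^ n) *\<^sub>o oct_underline \<beta>)))
     \<and> (let \<alpha> = (of_int p + csqrt (of_int (p\<^sup>2 + 4 * q))) / 2;
            \<beta> = (of_int p - csqrt (of_int (p\<^sup>2 + 4 * q))) / 2;
            A = of_int b - of_int a * \<beta>;
            B = of_int b - of_int a * \<alpha>
        in oct_complexify (horadam_octonion a b p q n) =
             (1 / (\<alpha> - \<beta>)) *\<^sub>o ((A * \<alpha> ^ n) *\<^sub>o oct_underline \<alpha> - (B * \<beta> ^ n) *\<^sub>o oct_underline \<beta>))"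
proof (intro conjI impI)
  assume "0 < p\<^sup>2 + 4 * q"
  define s where "s = sqrt (real_of_int (p\<^sup>2 + 4 * q))"
  have "0 < real_of_int (p\<^sup>2 + 4 * q)"
    using \<open>0 < p\<^sup>2 + 4 * q\<close> by (simp only: of_int_0_less_iff)
  then have "s \<noteq> 0" and "s\<^sup>2 = real_of_int (p\<^sup>2 + 4 * q)"
    \<comment> \<open>The discriminant has to stay a single \<open>of_int\<close> term for its
      positivity to apply.\<close>
    unfolding s_def by (auto simp del: of_int_add of_int_power of_int_mult)
  then have "s\<^sup>2 = (real_of_int p)\<^sup>2 + 4 * real_of_int q"
    by simp
  note vieta = quadratic_roots_vieta[OF this]
  \<comment> \<open>The roots differ by exactly \<open>s\<close>.\<close>
  have "(real_of_int p + s) / 2 \<noteq> (real_of_int p - s) / 2"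
    using \<open>s \<noteq> 0\<close> by simp
  note horadam_octonion_binet[OF vieta this, of a b n]
  then show "let \<alpha> = (real_of_int p + sqrt (real_of_int (p\<^sup>2 + 4 * q))) / 2;
            \<beta> = (real_of_int p - sqrt (real_of_int (p\<^sup>2 + 4 * q))) / 2;
            A = real_of_int b - real_of_int a * \<beta>;
            B = real_of_int b - real_of_int a * \<alpha>
        in horadam_octonion a b p q n =
             (1 / (\<alpha> - \<beta>)) *\<^sub>o ((A * \<alpha> ^ n) *\<^sub>o oct_underline \<alpha> - (B * \<beta> ^ n) *\<^sub>o oct_underline \<beta>)"
    unfolding Let_def horadam_octonion_def s_def .
next
  define s where "s = csqrt (of_int (p\<^sup>2 + 4 * q))"
  have s2: "s\<^sup>2 = of_int (p\<^sup>2 + 4 * q)"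
    unfolding s_def by (rule power2_csqrt)
  then have "s \<noteq> 0"
    using assms by (metis of_int_eq_0_iff zero_power2)
  have "s\<^sup>2 = (of_int p)\<^sup>2 + 4 * of_int q"
    using s2 by simp
  note vieta = quadratic_roots_vieta[OF this]
  have "(of_int p + s) / 2 \<noteq> (of_int p - s) / 2"
    using \<open>s \<noteq> 0\<close> by (simp add: eq_neg_iff_add_eq_0)
  note binet = horadam_octonion_binet[OF vieta this, of a b n]
  \<comment> \<open>The coordinates are integers, so complexifying merely reads them in the complex
    field, where the general formula applies.\<close>
  have "oct_complexify (horadam_octonion a b p q n) =
      (\<Sum>k\<le>7. of_int (horadam a b p q (n + k)) *\<^sub>o oct_basis k)"
    unfolding horadam_octonion_def sum_oct_basis by simp
  then show "let \<alpha> = (of_int p + csqrt (of_int (p\<^sup>2 + 4 * q))) / 2;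
            \<beta> = (of_int p - csqrt (of_int (p\<^sup>2 + 4 * q))) / 2;
            A = of_int b - of_int a * \<beta>;
            B = of_int b - of_int a * \<alpha>
        in oct_complexify (horadam_octonion a b p q n) =
             (1 / (\<alpha> - \<beta>)) *\<^sub>o ((A * \<alpha> ^ n) *\<^sub>o oct_underline \<alpha> - (B * \<beta> ^ n) *\<^sub>o oct_underline \<beta>)"
    using binet unfolding Let_def s_def by simp
qed

end
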